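(* Let $Q>0$, $N>0$, $X_0\sim\mathcal N(0,Q)$, $Z_1\sim\mathcal N(0,N)$ independent, $X_1=X_0+U_1$, $Y_1=X_1+Z_1$, and for a control $U_1=\gamma_1(X_0)$ let the power cost be $P=\mathbb E[U_1^2]$ and the estimation cost be $S=\mathbb E[(X_1-\mathbb E[X_1\mid Y_1])^2]$. (i) (Optimal linear strategy.) Let $$S_\ell(P)=\frac{(\sqrt Q-\sqrt P)^2N}{(\sqrt Q-\sqrt P)^2+N}\quad\text{for }P\in[0,Q].$$ Then $\lim_{P\to0^+}\frac{dS_\ell(P)}{dP}=-\infty$. (ii) (BPSK LoPE strategy.) For $a\ge0$ let $U_1=-a\,\mathrm{sign}(X_0)$, with power cost $P_{\mathrm{BPSK}}(a)=a^2$ and estimation cost $S_{\mathrm{BPSK}}(a)$. Then the estimation cost, viewed as a function of the power $P=a^2$, satisfies $$\lim_{a\to0^+}\frac{\partial S_{\mathrm{BPSK}}(a)}{\partial P_{\mathrm{BPSK}}(a)}=\lim_{a\to0^+}\frac{1}{2a}\frac{dS_{\mathrm{BPSK}}(a)}{da}=-\infty.$$ In particular, both strategies have estimation-cost derivative $S'(P)=-\infty$ at $P=0$, where $S(0)=\frac{QN}{Q+N}$.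
   Context: Setting of the Witsenhausen counterexample: the first decision-maker observes $X_0$ and outputs $U_1$; the second observes $Y_1$ and outputs the minimum mean-square error estimate $\mathbb E[X_1\mid Y_1]$. $S_\ell(P)$ is the estimation cost of the best linear policy $U_1=-\sqrt{P/Q}\,X_0$ at power $P\le Q$. The BPSK strategy is the $n=1$ case of the low-power estimation (LoPE) scheme. *)

theory Defs
  imports "HOL-Probability.Probability"
begin

text \<open>Estimation cost of the best linear policy at power P (0 \<le> P \<le> Q).\<close>
definition S_lin :: "real \<Rightarrow> real \<Rightarrow> real \<Rightarrow> real" where
  "S_lin Q N P = (sqrt Q - sqrt P)^2 * N / ((sqrt Q - sqrt P)^2 + N)"

definition wit_X1 :: "('a \<Rightarrow> real) \<Rightarrow> (real \<Rightarrow> real) \<Rightarrow> 'a \<Rightarrow> real" where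
  "wit_X1 X0 \<gamma> = (\<lambda>\<omega>. X0 \<omega> + \<gamma> (X0 \<omega>))"

definition wit_Y1 :: "('a \<Rightarrow> real) \<Rightarrow> ('a \<Rightarrow> real) \<Rightarrow> (real \<Rightarrow> real) \<Rightarrow> 'a \<Rightarrow> real" where
  "wit_Y1 X0 Z1 \<gamma> = (\<lambda>\<omega>. wit_X1 X0 \<gamma> \<omega> + Z1 \<omega>)"

definition power_cost :: "'a measure \<Rightarrow> ('a \<Rightarrow> real) \<Rightarrow> (real \<Rightarrow> real) \<Rightarrow> real" where
  "power_cost M X0 \<gamma> = (\<integral>\<omega>. (\<gamma> (X0 \<omega>))^2 \<partial>M)"

definition est_cost :: "'a measure \<Rightarrow> ('a \<Rightarrow> real) \<Rightarrow> ('a \<Rightarrow> real) \<Rightarrow> (real \<Rightarrow> real) \<Rightarrow> real" where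
  "est_cost M X0 Z1 \<gamma> =
     (\<integral>\<omega>. (wit_X1 X0 \<gamma> \<omega>
            - real_cond_exp M (vimage_algebra (space M) (wit_Y1 X0 Z1 \<gamma>) borel) (wit_X1 X0 \<gamma>) \<omega>)^2 \<partial>M)"

definition bpsk :: "real \<Rightarrow> real \<Rightarrow> real" where
  "bpsk a x = - a * sgn x"

definition S_bpsk :: "'a measure \<Rightarrow> ('a \<Rightarrow> real) \<Rightarrow> ('a \<Rightarrow> real) \<Rightarrow> real \<Rightarrow> real" where
  "S_bpsk M X0 Z1 a = est_cost M X0 Z1 (bpsk a)"

end

theory Submission
  imports Defs "HOL-Real_Asymp.Real_Asymp"
begin

text \<open>
  Under BPSK the estimation cost is the expectation of \<open>X1\<^sup>2\<close> minus that of the squared conditional mean.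
  A Gaussian change of measure writes the conditional mean as a quotient of integrals over a fixed
  Gaussian measure that depend smoothly on the amplitude \<open>a\<close>, and domination shows that the cost is
  continuously differentiable near \<open>a = 0\<close>, negative amplitudes included. Its derivative at
  \<open>0\<close> needs no computation: the linear estimator that is optimal at \<open>a = 0\<close> costs at least as much
  for every \<open>a\<close>, with equality at \<open>0\<close>, so both costs have the same derivative there, namely
  \<open>- 2 (1 - rho)\<^sup>2 E\<bar>X0\<bar> < 0\<close>. Dividing by \<open>2 a\<close> sends the derivative with respect to power to
  \<open>-\<infinity>\<close>.
\<close>

section \<open>Limits and derivatives under the integral sign\<close>

lemma tendsto_integral_dominated:
  fixes f :: "'p::first_countable_topology \<Rightarrow> 'b \<Rightarrow> real"
  assumes meas: "\<And>a. a \<in> S \<Longrightarrow> f a \<in> borel_measurable M" "l \<in> borel_measurable M"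
    and g: "integrable M g"
    and bound: "\<And>a x. a \<in> S \<Longrightarrow> x \<in> space M \<Longrightarrow> \<bar>f a x\<bar> \<le> g x"
    and lim: "\<And>x. x \<in> space M \<Longrightarrow> ((\<lambda>a. f a x) \<longlongrightarrow> l x) (at a0 within S)"
  shows "((\<lambda>a. \<integral>x. f a x \<partial>M) \<longlongrightarrow> (\<integral>x. l x \<partial>M)) (at a0 within S)"
  \<comment> \<open>First countability reduces the limit in \<open>a\<close> to sequences in
    \<open>S - {a0}\<close>, where dominated convergence for sequences applies.\<close>
  unfolding tendsto_at_iff_sequentially comp_def
proof (intro allI impI)
  fix X :: "nat \<Rightarrow> 'p"
  assume X: "\<forall>i. X i \<in> S - {a0}" "X \<longlonglongrightarrow> a0"
  show "(\<lambda>i. \<integral>x. f (X i) x \<partial>M) \<longlonglongrightarrow> (\<integral>x. l x \<partial>M)"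
  proof (rule integral_dominated_convergence[where w=g])
    show "AE x in M. (\<lambda>i. f (X i) x) \<longlonglongrightarrow> l x"
      using lim X unfolding tendsto_at_iff_sequentially comp_def by (intro AE_I2) blast
  qed (use X meas g bound in auto)
qed

text \<open>The mean value inequality on the convex set \<open>S\<close> bounds every difference
  quotient at \<open>a0\<close> by \<open>g\<close>, so dominated convergence passes the limit of
  the quotients through the integral.\<close>

lemma has_real_derivative_integral:
  fixes f f' :: "real \<Rightarrow> 'b \<Rightarrow> real"
  assumes S: "open S" "convex S" "a0 \<in> S"
    and int: "\<And>a. a \<in> S \<Longrightarrow> integrable M (f a)"
    and meas: "f' a0 \<in> borel_measurable M"
    and g: "integrable M g"
    and der: "\<And>a x. a \<in> S \<Longrightarrow> x \<in> space M \<Longrightarrow> ((\<lambda>a. f a x) has_real_derivative f' a x) (at a)"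
    and bound: "\<And>a x. a \<in> S \<Longrightarrow> x \<in> space M \<Longrightarrow> \<bar>f' a x\<bar> \<le> g x"
  shows "((\<lambda>a. \<integral>x. f a x \<partial>M) has_real_derivative (\<integral>x. f' a0 x \<partial>M)) (at a0)"
proof -
  have eq: "(\<integral>x. (f a x - f a0 x) / (a - a0) \<partial>M) = ((\<integral>x. f a x \<partial>M) - (\<integral>x. f a0 x \<partial>M)) / (a - a0)"
    if "a \<in> S" for a
    using int[OF that] int[OF S(3)] by simp
  have "((\<lambda>a. \<integral>x. (f a x - f a0 x) / (a - a0) \<partial>M) \<longlongrightarrow> (\<integral>x. f' a0 x \<partial>M)) (at a0 within S)"
  proof (rule tendsto_integral_dominated[OF _ meas g])
    fix a assume a: "a \<in> S"
    show "(\<lambda>x. (f a x - f a0 x) / (a - a0)) \<in> borel_measurable M"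
      using int[OF a] int[OF S(3)] by (intro borel_measurable_divide borel_measurable_diff) auto
    fix x assume x: "x \<in> space M"
    have "norm (f a x - f a0 x) \<le> g x * norm (a - a0)"
      by (rule field_differentiable_bound[OF S(2), where f'="\<lambda>a. f' a x"])
        (use der bound x a S in \<open>auto intro: has_field_derivative_at_within\<close>)
    \<comment> \<open>This serves the case \<open>a = a0\<close>, where the quotient is
      \<open>0 / 0 = 0\<close>.\<close>
    moreover have "0 \<le> g x" using bound[OF a x] by linarith
    ultimately show "\<bar>(f a x - f a0 x) / (a - a0)\<bar> \<le> g x"
      by (cases "a = a0") (auto simp: abs_divide divide_le_eq)
  next
    fix x assume x: "x \<in> space M"
    show "((\<lambda>a. (f a x - f a0 x) / (a - a0)) \<longlongrightarrow> f' a0 x) (at a0 within S)"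
      using der[OF S(3) x] unfolding has_field_derivative_iff at_within_open[OF S(3,1)] .
  qed
  then have "((\<lambda>a. ((\<integral>x. f a x \<partial>M) - (\<integral>x. f a0 x \<partial>M)) / (a - a0)) \<longlongrightarrow> (\<integral>x. f' a0 x \<partial>M)) (at a0 within S)"
    by (rule Lim_transform_eventually) (use eq in \<open>unfold eventually_at_filter, intro always_eventually, blast\<close>)
  then show ?thesis
    unfolding has_field_derivative_iff at_within_open[OF S(3,1)] .
qed

text \<open>The product is dominated by the sum of the squares, from
  \<open>0 \<le> (\<bar>f x\<bar> - \<bar>g x\<bar>)\<^sup>2\<close>.\<close>

lemma integrable_mult_of_squares:
  fixes f g :: "'b \<Rightarrow> real"
  assumes [measurable]: "f \<in> borel_measurable M" "g \<in> borel_measurable M"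
    and f: "integrable M (\<lambda>x. (f x)\<^sup>2)" and g: "integrable M (\<lambda>x. (g x)\<^sup>2)"
  shows "integrable M (\<lambda>x. f x * g x)"
proof (rule Bochner_Integration.integrable_bound[OF Bochner_Integration.integrable_add[OF f g]])
  show "AE x in M. norm (f x * g x) \<le> norm ((f x)\<^sup>2 + (g x)\<^sup>2)"
  proof (rule AE_I2)
    fix x
    have "0 \<le> (\<bar>f x\<bar> - \<bar>g x\<bar>)\<^sup>2" by simp
    then have "2 * (\<bar>f x\<bar> * \<bar>g x\<bar>) \<le> (f x)\<^sup>2 + (g x)\<^sup>2" by (simp add: power2_diff)
    moreover have "0 \<le> \<bar>f x\<bar> * \<bar>g x\<bar>" by simp
    ultimately have "\<bar>f x\<bar> * \<bar>g x\<bar> \<le> (f x)\<^sup>2 + (g x)\<^sup>2" by linarith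
    then show "norm (f x * g x) \<le> norm ((f x)\<^sup>2 + (g x)\<^sup>2)" by (simp add: abs_mult)
  qed
qed simp

abbreviation normal_measure :: "real \<Rightarrow> real measure" where
  "normal_measure s \<equiv> density lborel (\<lambda>x. ennreal (normal_density 0 s x))"

text \<open>Completing the square shows that multiplying a centred Gaussian density by
  \<open>exp (k * x)\<close> gives a multiple of a Gaussian density with shifted mean. The two signs
  of \<open>x\<close> are covered by \<open>exp (K * x) + exp (- K * x)\<close>, for
  \<open>K\<close> of either sign. Exponentials of this kind dominate everything below, both in
  \<open>w\<close> and in \<open>y\<close>.\<close>

lemma integrable_normal_measure_exp_abs:
  assumes s: "0 < s"
  shows "integrable (normal_measure s) (\<lambda>x. exp (K * \<bar>x\<bar>))"
proof -
  have eq: "normal_density 0 s x * exp (k * x) = exp (k\<^sup>2 * s\<^sup>2 / 2) * normal_density (k * s\<^sup>2) s x" for k x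
  proof -
    have "-x\<^sup>2 / (2 * s\<^sup>2) + k * x = k\<^sup>2 * s\<^sup>2 / 2 + -(x - k * s\<^sup>2)\<^sup>2 / (2 * s\<^sup>2)"
      using s by (simp add: field_simps power2_eq_square)
    then show ?thesis by (simp add: normal_density_def exp_add[symmetric])
  qed
  have i: "integrable (normal_measure s) (\<lambda>x. exp (k * x))" for k
    by (subst integrable_density) (use s in \<open>auto simp: eq\<close>)
  have "exp (K * \<bar>x\<bar>) \<le> \<bar>exp (K * x) + exp (- K * x)\<bar>" for x
    using exp_ge_zero[of "K * x"] exp_ge_zero[of "- K * x"] by (cases "0 \<le> x") (simp_all del: exp_ge_zero)
  then show ?thesis
    by (intro Bochner_Integration.integrable_bound[OF Bochner_Integration.integrable_add[OF i[of K] i[of "-K"]]] AE_I2)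
      simp_all
qed

section \<open>The Gaussian channel in coordinates adapted to the output\<close>

locale gaussian_channel =
  fixes Q N :: real
  assumes Q: "0 < Q" and N: "0 < N"
begin

definition rho where "rho = Q / (Q + N)"
definition tau where "tau = sqrt (Q * N / (Q + N))"

abbreviation "\<mu> \<equiv> normal_measure (sqrt (Q + N))"
abbreviation "\<nu> \<equiv> normal_measure 1"

text \<open>
  At amplitude \<open>0\<close> the output \<open>y\<close> has law \<open>\<mu>\<close>, and given \<open>y\<close> the input \<open>X0\<close> is Gaussian with
  mean \<open>rho * y\<close> and standard deviation \<open>tau\<close>; so \<open>(y, w)\<close> with \<open>w\<close> standard normal
  parametrizes the joint law of input and output. \<open>lik a\<close> is the likelihood ratio between
  amplitudes \<open>a\<close> and \<open>0\<close> in these coordinates, and \<open>num a y / den a y\<close> is the conditional mean of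
  \<open>X1\<close> given that the output is \<open>y\<close>. Primes denote derivatives in \<open>a\<close>.
\<close>

definition source :: "real \<Rightarrow> real \<Rightarrow> real" where
  "source y w = rho * y + tau * w"
definition x1 :: "real \<Rightarrow> real \<Rightarrow> real \<Rightarrow> real" where
  "x1 a y w = source y w - a * sgn (source y w)"
definition lik :: "real \<Rightarrow> real \<Rightarrow> real \<Rightarrow> real" where
  "lik a y w = exp (((y - source y w)\<^sup>2 - (y - x1 a y w)\<^sup>2) / (2 * N))"
definition lik' :: "real \<Rightarrow> real \<Rightarrow> real \<Rightarrow> real" where
  "lik' a y w = - sgn (source y w) * (y - x1 a y w) / N * lik a y w"

definition den where "den a y = (\<integral>w. lik a y w \<partial>\<nu>)"
definition den' where "den' a y = (\<integral>w. lik' a y w \<partial>\<nu>)"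
definition num where "num a y = (\<integral>w. x1 a y w * lik a y w \<partial>\<nu>)"
definition num' where
  "num' a y = (\<integral>w. x1 a y w * lik' a y w - sgn (source y w) * lik a y w \<partial>\<nu>)"

lemma prob_mu: "prob_space \<mu>" and prob_nu: "prob_space \<nu>"
  using Q N by (auto intro!: prob_space_normal_density)

sublocale mu: prob_space \<mu> by (rule prob_mu)
sublocale nu: prob_space \<nu> by (rule prob_nu)
sublocale munu: pair_prob_space \<mu> \<nu> ..

lemma measurable_channel [measurable]:
  "(\<lambda>p. source (fst p) (snd p)) \<in> borel_measurable (borel \<Otimes>\<^sub>M borel)"
  "(\<lambda>p. x1 a (fst p) (snd p)) \<in> borel_measurable (borel \<Otimes>\<^sub>M borel)"
  "(\<lambda>p. lik a (fst p) (snd p)) \<in> borel_measurable (borel \<Otimes>\<^sub>M borel)"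
  "(\<lambda>p. lik' a (fst p) (snd p)) \<in> borel_measurable (borel \<Otimes>\<^sub>M borel)"
  unfolding lik'_def lik_def x1_def source_def by measurable

lemma measurable_channel_snd [measurable]:
  "source y \<in> borel_measurable borel" "x1 a y \<in> borel_measurable borel"
  "lik a y \<in> borel_measurable borel" "lik' a y \<in> borel_measurable borel"
  unfolding lik'_def lik_def x1_def source_def by measurable

lemma measurable_num_den [measurable]:
  "den a \<in> borel_measurable borel" "den' a \<in> borel_measurable borel"
  "num a \<in> borel_measurable borel" "num' a \<in> borel_measurable borel"
proof -
  have mean_abs: "(\<lambda>y. \<integral>w. f (y, w) \<partial>\<nu>) \<in> borel_measurable borel"
    if "f \<in> borel_measurable (borel \<Otimes>\<^sub>M borel)" for f :: "real \<times> real \<Rightarrow> real"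
    by (rule nu.borel_measurable_lebesgue_integral) (use that in \<open>simp cong: measurable_cong_sets\<close>)
  show "den a \<in> borel_measurable borel" "den' a \<in> borel_measurable borel"
    "num a \<in> borel_measurable borel" "num' a \<in> borel_measurable borel"
    unfolding den_def[abs_def] den'_def[abs_def] num_def[abs_def] num'_def[abs_def]
    using mean_abs[of "\<lambda>p. lik a (fst p) (snd p)"] mean_abs[of "\<lambda>p. lik' a (fst p) (snd p)"]
      mean_abs[of "\<lambda>p. x1 a (fst p) (snd p) * lik a (fst p) (snd p)"]
      mean_abs[of "\<lambda>p. x1 a (fst p) (snd p) * lik' a (fst p) (snd p) - sgn (source (fst p) (snd p)) * lik a (fst p) (snd p)"]
    by simp_all
qed

section \<open>Derivatives in the amplitude, dominated uniformly for
  \<open>-1 < a < 1\<close>\<close>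

lemma x1_deriv: "((\<lambda>a. x1 a y w) has_real_derivative - sgn (source y w)) (at a)"
  \<comment> \<open>The sign does not depend on \<open>a\<close>, so its jump in the source does no
    harm: \<open>x1\<close> is affine in \<open>a\<close> for every fixed \<open>y\<close> and
    \<open>w\<close>.\<close>
  unfolding x1_def by (auto intro!: derivative_eq_intros)

lemma lik_deriv: "((\<lambda>a. lik a y w) has_real_derivative lik' a y w) (at a)"
  unfolding lik_def lik'_def using N
  by (auto intro!: derivative_eq_intros x1_deriv simp: field_simps)

lemma x1_lik_deriv:
  "((\<lambda>a. x1 a y w * lik a y w) has_real_derivative
     x1 a y w * lik' a y w - sgn (source y w) * lik a y w) (at a)"
  by (auto intro!: derivative_eq_intros x1_deriv lik_deriv)

text \<open>Without the factor 3, the constant times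
  \<open>1 + \<bar>y\<bar> + \<bar>w\<bar>\<close> is a common bound \<open>T\<close> for
  \<open>\<bar>x1 a y w\<bar>\<close>, for \<open>\<bar>y - x1 a y w\<bar> / N\<close> and for the
  absolute value of the exponent of \<open>lik\<close>. The longest product to be bounded,
  \<open>x1 * lik'\<close>, consists of three such factors, each at most \<open>exp T\<close>; this
  accounts for the 3.\<close>

definition rate where "rate = 3 * (2 * (1 + tau) * (1 + 1 / N))"

text \<open>The exponent of \<open>lik\<close> is a difference of two squares whose bases differ by
  \<open>a * sgn (source y w)\<close>. It therefore factors and grows only linearly in
  \<open>\<bar>y\<bar> + \<bar>w\<bar>\<close>, so that one exponential, independent of
  \<open>a\<close>, dominates all the integrands. The 2 in \<open>G\<close> pays for the two terms
  of the integrand of \<open>num'\<close>. The lower bound \<open>exp (- T)\<close> is weakened so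
  that the same \<open>rate\<close> serves on both sides.\<close>

lemma lik_bounds:
  fixes a y w :: real
  assumes a: "a \<in> {-1<..<1}"
  defines "G \<equiv> 2 * exp (rate * (1 + \<bar>y\<bar> + \<bar>w\<bar>))"
  shows "\<bar>lik a y w\<bar> \<le> G" "\<bar>lik' a y w\<bar> \<le> G" "\<bar>x1 a y w * lik a y w\<bar> \<le> G"
    "\<bar>x1 a y w * lik' a y w - sgn (source y w) * lik a y w\<bar> \<le> G"
    and "exp (- (rate * (1 + \<bar>y\<bar> + \<bar>w\<bar>))) \<le> lik a y w"
proof -
  define t where "t = 1 + \<bar>y\<bar> + \<bar>w\<bar>"
  define T where "T = 2 * (1 + tau) * (1 + 1 / N) * t"
  have rho: "0 \<le> rho" "rho \<le> 1" using Q N by (auto simp: rho_def)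
  have tau: "0 \<le> tau" using Q N by (simp add: tau_def)
  define s where "s = sgn (source y w)"
  have s: "\<bar>s\<bar> \<le> 1" by (simp add: s_def sgn_if)
  have "\<bar>source y w\<bar> \<le> rho * \<bar>y\<bar> + tau * \<bar>w\<bar>"
    unfolding source_def using rho tau by (metis abs_mult abs_of_nonneg abs_triangle_ineq)
  also have "\<dots> \<le> \<bar>y\<bar> + tau * \<bar>w\<bar>" using rho by (simp add: mult_left_le_one_le)
  finally have x: "\<bar>source y w\<bar> \<le> \<bar>y\<bar> + tau * \<bar>w\<bar>" .
  have as: "\<bar>a * s\<bar> \<le> 1" unfolding abs_mult using a s by (intro mult_le_one) auto
  have x1: "\<bar>x1 a y w\<bar> \<le> \<bar>y\<bar> + tau * \<bar>w\<bar> + 1"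
    using x as unfolding x1_def s_def[symmetric] by linarith
  have t1: "\<bar>y\<bar> + tau * \<bar>w\<bar> + 1 \<le> (1 + tau) * t"
    using tau by (simp add: t_def algebra_simps)
  have pos: "0 \<le> (1 + tau) * t" "1 \<le> t" using tau by (auto simp: t_def)
  have T: "T = 2 * ((1 + tau) * t) + (2 * ((1 + tau) * t)) / N" by (simp add: T_def algebra_simps add_divide_distrib)
  have quot: "0 \<le> (2 * ((1 + tau) * t)) / N" using pos N by simp
  have x1T: "\<bar>x1 a y w\<bar> \<le> T" using x1 t1 pos quot T by linarith
  have "\<bar>y - x1 a y w\<bar> \<le> 2 * ((1 + tau) * t)" using x1 t1 tau pos abs_ge_zero[of w]
    mult_nonneg_nonneg[OF tau abs_ge_zero[of w]] by linarith
  then have "\<bar>y - x1 a y w\<bar> / N \<le> (2 * ((1 + tau) * t)) / N" using N by (simp add: divide_right_mono)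
  then have dT: "\<bar>y - x1 a y w\<bar> / N \<le> T" using T pos by linarith
  have "0 \<le> T" using T pos quot by linarith
  have "\<bar>((y - source y w)\<^sup>2 - (y - x1 a y w)\<^sup>2)\<bar> = \<bar>a * s\<bar> * \<bar>2 * (y - source y w) + a * s\<bar>"
    unfolding abs_mult[symmetric] x1_def s_def[symmetric] abs_minus_cancel[of "a * s * _", symmetric]
    by (rule arg_cong[where f=abs]) (simp add: power2_eq_square algebra_simps)
  also have "\<dots> \<le> 1 * \<bar>2 * (y - source y w) + a * s\<bar>" by (rule mult_right_mono[OF as]) simp
  also have "\<dots> \<le> 2 * (\<bar>y\<bar> + \<bar>source y w\<bar>) + \<bar>a * s\<bar>"
    using abs_triangle_ineq[of "2 * (y - source y w)" "a * s"] abs_triangle_ineq4[of y "source y w"]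
    unfolding abs_mult[of 2] by simp
  also have "\<dots> \<le> 2 * (2 * ((1 + tau) * t))"
    using x as t1 mult_nonneg_nonneg[OF tau abs_ge_zero[of w]] unfolding distrib_left by linarith
  finally have "\<bar>(y - source y w)\<^sup>2 - (y - x1 a y w)\<^sup>2\<bar> / (2 * N) \<le> 2 * (2 * ((1 + tau) * t)) / (2 * N)"
    using N by (intro divide_right_mono) auto
 also have "2 * (2 * ((1 + tau) * t)) / (2 * N) = (2 * ((1 + tau) * t)) / N" by simp
  finally have ex: "\<bar>((y - source y w)\<^sup>2 - (y - x1 a y w)\<^sup>2) / (2 * N)\<bar> \<le> T"
    using T pos N unfolding abs_divide by simp
  have lik: "0 < lik a y w" "lik a y w \<le> exp T" "exp (- T) \<le> lik a y w"
    using abs_le_D1[OF ex] abs_le_D2[OF ex] unfolding lik_def by simp_all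
  have rT: "rate * (1 + \<bar>y\<bar> + \<bar>w\<bar>) = 3 * T" by (simp add: rate_def T_def t_def)
  have eT: "T \<le> exp T" "1 \<le> exp T" using exp_ge_add_one_self[of T] \<open>0 \<le> T\<close> by linarith+
  have ss: "\<bar>sgn (source y w)\<bar> \<le> 1" using s s_def by simp
  have lik': "\<bar>lik' a y w\<bar> \<le> exp T * exp T"
  proof -
    have "\<bar>lik' a y w\<bar> = \<bar>s\<bar> * (\<bar>y - x1 a y w\<bar> / N) * lik a y w"
      using lik N by (simp add: lik'_def abs_mult s_def)
    also have "\<dots> \<le> 1 * exp T * exp T"
      by (intro mult_mono) (use s dT eT lik N in auto)
    finally show ?thesis by simp
  qed
  have G: "exp T * exp T * exp T = exp (rate * (1 + \<bar>y\<bar> + \<bar>w\<bar>))"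
    unfolding rT by (simp add: exp_add[symmetric])
  have e2: "exp T * exp T \<le> exp T * exp T * exp T" "exp T \<le> exp T * exp T"
    using eT by simp_all
  have G2: "G = 2 * (exp T * exp T * exp T)" by (simp add: G_def G)
  show "\<bar>lik a y w\<bar> \<le> G" using lik e2 G2 by linarith
  show "\<bar>lik' a y w\<bar> \<le> G" using lik' e2 eT G2 by linarith
  have "\<bar>x1 a y w * lik a y w\<bar> \<le> exp T * exp T"
    unfolding abs_mult by (intro mult_mono) (use x1T eT lik in auto)
  then show "\<bar>x1 a y w * lik a y w\<bar> \<le> G" using e2 eT G2 by linarith
  have "\<bar>x1 a y w * lik' a y w\<bar> \<le> exp T * (exp T * exp T)"
    unfolding abs_mult by (intro mult_mono) (use x1T eT lik' in auto)
  moreover have "\<bar>sgn (source y w) * lik a y w\<bar> \<le> 1 * exp T"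
    unfolding abs_mult by (intro mult_mono) (use ss lik in auto)
  ultimately show "\<bar>x1 a y w * lik' a y w - sgn (source y w) * lik a y w\<bar> \<le> G"
    using abs_triangle_ineq4[of "x1 a y w * lik' a y w" "sgn (source y w) * lik a y w"] G2 e2 unfolding mult.assoc by linarith
  show "exp (- (rate * (1 + \<bar>y\<bar> + \<bar>w\<bar>))) \<le> lik a y w"
    unfolding rT using lik \<open>0 \<le> T\<close> by (intro order_trans[OF _ lik(3)]) simp
qed

lemma integrable_dom_nu: "integrable \<nu> (\<lambda>w. 2 * exp (rate * (1 + \<bar>y\<bar> + \<bar>w\<bar>)))"
proof -
  have "2 * exp (rate * (1 + \<bar>y\<bar> + \<bar>w\<bar>)) = 2 * exp (rate * (1 + \<bar>y\<bar>)) * exp (rate * \<bar>w\<bar>)" for w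
    by (simp add: exp_add[symmetric] algebra_simps)
  then show ?thesis using integrable_normal_measure_exp_abs[of 1 rate] by simp
qed

lemma integrable_lik:
  assumes a: "a \<in> {-1<..<1}"
  shows "integrable \<nu> (lik a y)" "integrable \<nu> (lik' a y)" "integrable \<nu> (\<lambda>w. x1 a y w * lik a y w)"
    "integrable \<nu> (\<lambda>w. x1 a y w * lik' a y w - sgn (source y w) * lik a y w)"
  by (rule Bochner_Integration.integrable_bound[OF integrable_dom_nu[of y]];
      use lik_bounds[OF a, of y] in \<open>simp add: abs_mult\<close>)+

lemma den_deriv:
  assumes "a \<in> {-1<..<1}"
  shows "((\<lambda>a. den a y) has_real_derivative den' a y) (at a)"
  unfolding den_def den'_def
  by (rule has_real_derivative_integral[OF _ _ assms _ _ integrable_dom_nu[of y]])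
    (use integrable_lik lik_bounds lik_deriv in auto)

lemma num_deriv:
  assumes "a \<in> {-1<..<1}"
  shows "((\<lambda>a. num a y) has_real_derivative num' a y) (at a)"
  unfolding num_def num'_def
  by (rule has_real_derivative_integral[OF _ _ assms _ _ integrable_dom_nu[of y]])
    (use integrable_lik lik_bounds x1_lik_deriv in auto)

lemma lik_isCont: "isCont (\<lambda>a. x1 a y w) a" "isCont (\<lambda>a. lik a y w) a" "isCont (\<lambda>a. lik' a y w) a"
proof -
  show 1: "isCont (\<lambda>a. x1 a y w) a" "isCont (\<lambda>a. lik a y w) a"
    using x1_deriv lik_deriv DERIV_isCont by blast+
  then show "isCont (\<lambda>a. lik' a y w) a"
    unfolding lik'_def using N by (intro continuous_intros) auto
qed

lemma den'_num'_tendsto: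
  assumes a: "a \<in> {-1<..<1}"
  shows "((\<lambda>a. den' a y) \<longlongrightarrow> den' a y) (at a)" "((\<lambda>a. num' a y) \<longlongrightarrow> num' a y) (at a)"
proof -
  have "((\<lambda>a. den' a y) \<longlongrightarrow> den' a y) (at a within {-1<..<1})"
    unfolding den'_def
    by (rule tendsto_integral_dominated[OF _ _ integrable_dom_nu[of y]])
      (use lik_bounds lik_isCont a in \<open>auto simp: at_within_open[OF a open_greaterThanLessThan] isCont_def\<close>)
  moreover have "((\<lambda>a. num' a y) \<longlongrightarrow> num' a y) (at a within {-1<..<1})"
    unfolding num'_def
    by (rule tendsto_integral_dominated[OF _ _ integrable_dom_nu[of y]])
      (use lik_bounds lik_isCont a in \<open>auto simp: at_within_open[OF a open_greaterThanLessThan] isCont_def intro!: tendsto_intros\<close>)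
  ultimately show "((\<lambda>a. den' a y) \<longlongrightarrow> den' a y) (at a)" "((\<lambda>a. num' a y) \<longlongrightarrow> num' a y) (at a)"
    by (simp_all add: at_within_open[OF a open_greaterThanLessThan])
qed

section \<open>Growth in the output, and the energy of the conditional mean\<close>

definition upper_const where "upper_const = (\<integral>w. 2 * exp (rate * (1 + \<bar>w\<bar>)) \<partial>\<nu>)"
definition lower_const where "lower_const = (\<integral>w. exp (- (rate * (1 + \<bar>w\<bar>))) \<partial>\<nu>)"

lemma integrable_lower_const: "integrable \<nu> (\<lambda>w. exp (- (rate * (1 + \<bar>w\<bar>))))"
proof -
  have "exp (- (rate * (1 + \<bar>w\<bar>))) = exp (- rate) * exp ((- rate) * \<bar>w\<bar>)" for w
    by (simp add: exp_add[symmetric] algebra_simps)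
  then show ?thesis using integrable_normal_measure_exp_abs[of 1 "-rate"] by simp
qed

lemma lower_const_pos: "0 < lower_const"
proof -
  have "emeasure \<nu> (space \<nu>) \<noteq> 0" using nu.emeasure_space_1 by simp
  then show ?thesis unfolding lower_const_def 
    using nu.integral_less_AE_space[OF _ integrable_lower_const, of "\<lambda>_. 0"] by simp
qed

lemma upper_const_pos: "0 \<le> upper_const" unfolding upper_const_def by simp

text \<open>The exponent of the dominating function is a sum of a part in \<open>y\<close> and a
  part in \<open>w\<close>, so the \<open>y\<close> part leaves the integral and
  \<open>upper_const\<close> and \<open>lower_const\<close> remain. The lower bound on
  \<open>den\<close> ensures that quotients by \<open>den\<close> still grow at most exponentially
  in \<open>\<bar>y\<bar>\<close>.\<close>

lemma num_den_bounds:
  fixes a y :: real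
  assumes a: "a \<in> {-1<..<1}"
  defines "U \<equiv> upper_const * exp (rate * \<bar>y\<bar>)"
  shows "\<bar>den' a y\<bar> \<le> U" "\<bar>num a y\<bar> \<le> U" "\<bar>num' a y\<bar> \<le> U"
    and "lower_const * exp (- (rate * \<bar>y\<bar>)) \<le> den a y"
proof -
  have "U = (\<integral>w. (2 * exp (rate * (1 + \<bar>w\<bar>))) * exp (rate * \<bar>y\<bar>) \<partial>\<nu>)"
    by (simp add: U_def upper_const_def)
  also have "\<dots> = (\<integral>w. 2 * exp (rate * (1 + \<bar>y\<bar> + \<bar>w\<bar>)) \<partial>\<nu>)"
    by (rule Bochner_Integration.integral_cong) (auto simp: exp_add[symmetric] algebra_simps)
  finally have U: "U = \<dots>" .
  have b: "\<bar>\<integral>w. f w \<partial>\<nu>\<bar> \<le> U" if "integrable \<nu> f" "\<And>w. \<bar>f w\<bar> \<le> 2 * exp (rate * (1 + \<bar>y\<bar> + \<bar>w\<bar>))" for f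
  proof -
    have "\<bar>\<integral>w. f w \<partial>\<nu>\<bar> \<le> (\<integral>w. \<bar>f w\<bar> \<partial>\<nu>)" by (rule integral_abs_bound)
    also have "\<dots> \<le> U" unfolding U
      by (rule integral_mono) (use that integrable_dom_nu in auto)
    finally show ?thesis .
  qed
  show "\<bar>den' a y\<bar> \<le> U" "\<bar>num a y\<bar> \<le> U" "\<bar>num' a y\<bar> \<le> U"
    unfolding den'_def num_def num'_def
    by (rule b; use integrable_lik[OF a] lik_bounds[OF a] in simp)+
  have "lower_const * exp (- (rate * \<bar>y\<bar>)) = (\<integral>w. exp (- (rate * (1 + \<bar>w\<bar>))) * exp (- (rate * \<bar>y\<bar>)) \<partial>\<nu>)"
    by (simp add: lower_const_def)
  also have "\<dots> \<le> den a y" unfolding den_def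
  proof (rule integral_mono)
    fix w
    have "exp (- (rate * (1 + \<bar>w\<bar>))) * exp (- (rate * \<bar>y\<bar>)) = exp (- (rate * (1 + \<bar>y\<bar> + \<bar>w\<bar>)))"
      by (simp add: exp_add[symmetric] algebra_simps)
    then show "exp (- (rate * (1 + \<bar>w\<bar>))) * exp (- (rate * \<bar>y\<bar>)) \<le> lik a y w"
      using lik_bounds(5)[OF a] by simp
  qed (use integrable_lower_const integrable_lik[OF a] in auto)
  finally show "lower_const * exp (- (rate * \<bar>y\<bar>)) \<le> den a y" .
qed

lemma den_pos: "a \<in> {-1<..<1} \<Longrightarrow> 0 < den a y"
  using num_den_bounds(4)[of a y] lower_const_pos mult_pos_pos[OF lower_const_pos exp_gt_zero, of "- (rate * \<bar>y\<bar>)"]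
  by linarith

text \<open>This is the square of the conditional mean \<open>num / den\<close>, weighted by the
  density \<open>den\<close> of the output relative to \<open>\<mu>\<close>. Its integral over
  \<open>\<mu>\<close> is the second moment of the estimate.\<close>

definition energy where "energy a y = (num a y)\<^sup>2 / den a y"
definition energy' where
  "energy' a y = 2 * num a y * num' a y / den a y - (num a y)\<^sup>2 * den' a y / (den a y)\<^sup>2"

lemma measurable_energy [measurable]: "energy a \<in> borel_measurable borel" "energy' a \<in> borel_measurable borel"
  unfolding energy_def energy'_def by measurable

lemma energy_deriv:
  assumes "a \<in> {-1<..<1}"
  shows "((\<lambda>a. energy a y) has_real_derivative energy' a y) (at a)"
proof -
  have "((\<lambda>a. energy a y) has_real_derivative
      ((of_nat 2 * (num' a y * num a y ^ (2 - Suc 0))) * den a y - (num a y)\<^sup>2 * den' a y) / (den a y * den a y)) (at a)"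
    unfolding energy_def
    by (intro DERIV_divide DERIV_power num_deriv den_deriv assms) (use den_pos[OF assms, of y] in simp)
  also have "((of_nat 2 * (num' a y * num a y ^ (2 - Suc 0))) * den a y - (num a y)\<^sup>2 * den' a y) / (den a y * den a y)
      = energy' a y"
    unfolding energy'_def using den_pos[OF assms, of y] by (simp add: diff_divide_distrib power2_eq_square)
  finally show ?thesis .
qed

lemma energy'_tendsto:
  assumes "a \<in> {-1<..<1}"
  shows "((\<lambda>a. energy' a y) \<longlongrightarrow> energy' a y) (at a)"
proof -
  have "((\<lambda>a. num a y) \<longlongrightarrow> num a y) (at a)" "((\<lambda>a. den a y) \<longlongrightarrow> den a y) (at a)"
    using DERIV_isCont[OF num_deriv[OF assms]] DERIV_isCont[OF den_deriv[OF assms]]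
    by (auto simp: isCont_def)
  then show ?thesis unfolding energy'_def using den_pos[OF assms, of y]
    by (intro tendsto_diff tendsto_divide tendsto_mult tendsto_power tendsto_const den'_num'_tendsto assms) simp_all
qed

text \<open>The two coefficients belong to the two terms of \<open>energy'\<close>. The 5 comes from
  \<open>num\<^sup>2 * den' / den\<^sup>2\<close>: three factors above and two below the fraction
  line each contribute \<open>exp (rate * \<bar>y\<bar>)\<close>.\<close>

definition energy_bound where "energy_bound y = (2 * upper_const\<^sup>2 / lower_const + upper_const ^ 3 / lower_const\<^sup>2) * exp (5 * rate * \<bar>y\<bar>)"

lemma integrable_energy_bound: "integrable \<mu> energy_bound"
  unfolding energy_bound_def[abs_def]
  by (intro integrable_mult_right integrable_normal_measure_exp_abs) (use Q N in simp)

lemma rate_pos: "0 \<le> rate"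
  using Q N unfolding rate_def tau_def by simp

lemma energy_bounds:
  assumes a: "a \<in> {-1<..<1}"
  shows "\<bar>energy a y\<bar> \<le> energy_bound y" "\<bar>energy' a y\<bar> \<le> energy_bound y"
proof -
  define e where "e = exp (rate * \<bar>y\<bar>)"
  have e: "1 \<le> e" using rate_pos by (simp add: e_def)
  have ei: "exp (- (rate * \<bar>y\<bar>)) = 1 / e" unfolding e_def exp_minus inverse_eq_divide ..
  have e5: "exp (5 * rate * \<bar>y\<bar>) = e ^ 5"
    unfolding e_def exp_of_nat_mult[symmetric] by simp
  have e5': "e ^ 5 = e * e * e * e * e" by (simp add: eval_nat_numeral)
  note b = num_den_bounds[OF a, of y, folded e_def, unfolded ei]
  have dp: "0 < lower_const * (1 / e)" using lower_const_pos e by simp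
  have Ld: "lower_const * (1 / e) \<le> \<bar>den a y\<bar>" using b(4) by linarith
  have e0: "0 \<le> e" "0 < 1 / e" using e by simp_all
  have U0: "0 \<le> upper_const * e" using upper_const_pos e by simp
  have A: "\<bar>p * q / den a y\<bar> \<le> (upper_const * e) * (upper_const * e) / (lower_const * (1 / e))" 
    if "\<bar>p\<bar> \<le> upper_const * e" "\<bar>q\<bar> \<le> upper_const * e" for p q
    unfolding abs_divide abs_mult
    by (intro frac_le mult_mono mult_nonneg_nonneg that Ld dp U0 abs_ge_zero upper_const_pos lower_const_pos less_imp_le[OF lower_const_pos] e0 less_imp_le[OF e0(2)])
  \<comment> \<open>Quotients of a product of two factors by one \<open>den\<close> grow only like
    \<open>e ^ 3\<close>; as \<open>1 \<le> e\<close>, they fit under the common power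
    \<open>e ^ 5\<close>.\<close>
  have e35: "e ^ 3 \<le> e ^ 5" using e by (intro power_increasing) auto
  have Ae: "(upper_const * e) * (upper_const * e) / (lower_const * (1 / e)) = upper_const\<^sup>2 / lower_const * e ^ 3"
    using e lower_const_pos by (simp add: divide_simps power2_eq_square power3_eq_cube)
  have A': "(upper_const * e) * (upper_const * e) / (lower_const * (1 / e)) \<le> upper_const\<^sup>2 / lower_const * e ^ 5"
    unfolding Ae using e35 lower_const_pos by (intro mult_left_mono) auto
  have "\<bar>(num a y)\<^sup>2 * den' a y / (den a y)\<^sup>2\<bar> = \<bar>num a y\<bar> * \<bar>num a y\<bar> * \<bar>den' a y\<bar> / (\<bar>den a y\<bar> * \<bar>den a y\<bar>)"
    by (simp add: abs_mult power2_eq_square)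
  also have "\<dots> \<le> (upper_const * e) * (upper_const * e) * (upper_const * e) / ((lower_const * (1 / e)) * (lower_const * (1 / e)))"
    by (intro frac_le mult_mono mult_nonneg_nonneg mult_pos_pos b(1,2) Ld dp U0 abs_ge_zero upper_const_pos lower_const_pos less_imp_le[OF lower_const_pos] e0 less_imp_le[OF e0(2)])
  also have "\<dots> = upper_const ^ 3 / lower_const\<^sup>2 * e ^ 5"
    using e lower_const_pos e5' by (simp add: divide_simps power2_eq_square power3_eq_cube)
  finally have B: "\<bar>(num a y)\<^sup>2 * den' a y / (den a y)\<^sup>2\<bar> \<le> \<dots>" .
  have B0: "0 \<le> upper_const ^ 3 / lower_const\<^sup>2 * e ^ 5" using upper_const_pos e by simp
  have C0: "0 \<le> upper_const\<^sup>2 / lower_const * e ^ 5" using lower_const_pos e by simp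
  have bd: "energy_bound y = 2 * (upper_const\<^sup>2 / lower_const * e ^ 5) + upper_const ^ 3 / lower_const\<^sup>2 * e ^ 5"
    unfolding energy_bound_def e5 by (simp add: algebra_simps)
  show "\<bar>energy a y\<bar> \<le> energy_bound y"
    using A[OF b(2) b(2)] A' B0 C0 bd unfolding energy_def power2_eq_square[of "num a y"] by linarith
  show "\<bar>energy' a y\<bar> \<le> energy_bound y"
  proof -
    have "2 * num a y * num' a y / den a y = 2 * (num a y * num' a y / den a y)" by simp
    then show ?thesis
      using A[OF b(2) b(3)] A' B bd unfolding energy'_def by linarith
  qed
qed

lemma integrable_energy:
  assumes a: "a \<in> {-1<..<1}"
  shows "integrable \<mu> (energy a)"
  by (rule Bochner_Integration.integrable_bound[OF integrable_energy_bound];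
      use energy_bounds[OF a] in \<open>auto intro!: AE_I2 order_trans[OF _ abs_ge_self]\<close>)+

lemma integral_energy_deriv:
  assumes "a \<in> {-1<..<1}"
  shows "((\<lambda>a. \<integral>y. energy a y \<partial>\<mu>) has_real_derivative (\<integral>y. energy' a y \<partial>\<mu>)) (at a)"
  by (rule has_real_derivative_integral[OF _ _ assms _ _ integrable_energy_bound])
    (use integrable_energy energy_bounds energy_deriv in auto)

text \<open>Continuity of the derivative is needed besides its existence: the claim concerns the
  derivative of the cost at amplitudes \<open>a > 0\<close> tending to \<open>0\<close>, whereas the
  minimum argument determines it only at \<open>a = 0\<close>.\<close>

lemma integral_energy'_tendsto:
  assumes a: "a \<in> {-1<..<1}"
  shows "((\<lambda>a. \<integral>y. energy' a y \<partial>\<mu>) \<longlongrightarrow> (\<integral>y. energy' a y \<partial>\<mu>)) (at a)"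
proof -
  have "((\<lambda>a. \<integral>y. energy' a y \<partial>\<mu>) \<longlongrightarrow> (\<integral>y. energy' a y \<partial>\<mu>)) (at a within {-1<..<1})"
    by (rule tendsto_integral_dominated[OF _ _ integrable_energy_bound])
      (use energy_bounds energy'_tendsto a in \<open>auto simp: at_within_open[OF a open_greaterThanLessThan]\<close>)
  then show ?thesis by (simp add: at_within_open[OF a open_greaterThanLessThan])
qed

end

section \<open>The joint law of source and output\<close>

locale gaussian_source_channel = gaussian_channel Q N + prob_space M
  for Q N :: real and M :: "'a measure" +
  fixes X0 Z1 :: "'a \<Rightarrow> real"
  assumes X0: "distributed M lborel X0 (\<lambda>x. ennreal (normal_density 0 (sqrt Q) x))"
    and Z1: "distributed M lborel Z1 (\<lambda>x. ennreal (normal_density 0 (sqrt N) x))"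
    and ind: "indep_var borel X0 borel Z1"
begin

definition X1 where "X1 a = wit_X1 X0 (bpsk a)"
definition Y1 where "Y1 a = wit_Y1 X0 Z1 (bpsk a)"

lemma X1_eq: "X1 a \<omega> = X0 \<omega> - a * sgn (X0 \<omega>)" and Y1_eq: "Y1 a \<omega> = X1 a \<omega> + Z1 \<omega>"
  by (simp_all add: X1_def Y1_def wit_X1_def wit_Y1_def bpsk_def)

lemma measurable_X0_Z1 [measurable]: "X0 \<in> borel_measurable M" "Z1 \<in> borel_measurable M"
  using ind indep_var_rv1 indep_var_rv2 by blast+

lemma measurable_X1_Y1 [measurable]: "X1 a \<in> borel_measurable M" "Y1 a \<in> borel_measurable M"
  unfolding X1_eq[abs_def] Y1_eq[abs_def] by measurable

text \<open>For \<open>a = 0\<close> this is the factorization of the joint Gaussian density into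
  the output density and the density of the source given the output, with \<open>tau\<close> the
  Jacobian of \<open>w \<mapsto> source y w\<close>. The amplitude changes only the noise factor,
  and \<open>lik\<close> is the resulting ratio.\<close>

lemma joint_density:
  "normal_density 0 (sqrt Q) (source y w) * normal_density 0 (sqrt N) (y - x1 a y w) * tau
    = normal_density 0 (sqrt (Q + N)) y * std_normal_density w * lik a y w"
proof -
  have tau2: "tau\<^sup>2 = Q * N / (Q + N)" using Q N by (simp add: tau_def)
  have QN: "Q + N \<noteq> 0" using Q N by simp
  have c: "(1 / sqrt (2 * pi * Q)) * (1 / sqrt (2 * pi * N)) * tau
      = (1 / sqrt (2 * pi * (Q + N))) * (1 / sqrt (2 * pi))"
    using Q N by (simp add: tau_def real_sqrt_mult real_sqrt_divide)
  \<comment> \<open>The choice of \<open>rho\<close> cancels the mixed term in \<open>y\<close> and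
    \<open>w\<close>; the choice of \<open>tau\<close> then makes the remaining coefficient of
    \<open>w\<^sup>2\<close> vanish.\<close>
  have "(source y w)\<^sup>2 / Q + (y - source y w)\<^sup>2 / N - (y\<^sup>2 / (Q + N) + w\<^sup>2)
      = (tau\<^sup>2 * (Q + N) / (Q * N) - 1) * w\<^sup>2"
  proof -
    have y: "source y w = Q * y / (Q + N) + tau * w" "y - source y w = N * y / (Q + N) - tau * w"
      using QN by (simp_all add: source_def rho_def field_simps)
    have "(Q * y / (Q + N) + t)\<^sup>2 / Q + (N * y / (Q + N) - t)\<^sup>2 / N - y\<^sup>2 / (Q + N)
        = t\<^sup>2 * (Q + N) / (Q * N)" for t
    proof -
      define v where "v = y / (Q + N)"
      have v: "Q * y / (Q + N) = Q * v" "N * y / (Q + N) = N * v" "y\<^sup>2 / (Q + N) = v\<^sup>2 * (Q + N)"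
        using QN by (simp_all add: v_def power2_eq_square)
      show ?thesis unfolding v using Q N by (simp add: field_simps power2_eq_square)
    qed
    from this[of "tau * w"] show ?thesis unfolding y(2) unfolding y(1) by (simp add: algebra_simps power_mult_distrib)
  qed
  also have "\<dots> = 0" unfolding tau2 using Q N by simp
  finally have e: "(source y w)\<^sup>2 / Q + (y - source y w)\<^sup>2 / N = y\<^sup>2 / (Q + N) + w\<^sup>2" by simp
  have e2: "- (source y w)\<^sup>2 / (2 * Q) + - (y - x1 a y w)\<^sup>2 / (2 * N)
      = - y\<^sup>2 / (2 * (Q + N)) + - w\<^sup>2 / 2 + ((y - source y w)\<^sup>2 - (y - x1 a y w)\<^sup>2) / (2 * N)"
  proof -
    have h: "A / (2 * B) = A / B / 2" for A B :: real by simp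
    have g: "- (A / 2) + - (D / 2) = - (B / 2) + - (W / 2) + (C / 2 - D / 2)" if "A + C = B + W" for A B C D W :: real
      using that by linarith
    show ?thesis unfolding h diff_divide_distrib minus_divide_left[symmetric] by (rule g[OF e])
  qed
  have "normal_density 0 (sqrt Q) (source y w) * normal_density 0 (sqrt N) (y - x1 a y w) * tau
     = ((1 / sqrt (2 * pi * Q)) * (1 / sqrt (2 * pi * N)) * tau)
       * exp (- (source y w)\<^sup>2 / (2 * Q) + - (y - x1 a y w)\<^sup>2 / (2 * N))"
    unfolding exp_add using Q N by (simp add: normal_density_def)
  also have "\<dots> = normal_density 0 (sqrt (Q + N)) y * std_normal_density w * lik a y w"
    unfolding c e2 exp_add using Q N by (simp add: normal_density_def lik_def)
  finally show ?thesis .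
qed

lemma law_X0_Z1:
  "distr M (borel \<Otimes>\<^sub>M borel) (\<lambda>\<omega>. (X0 \<omega>, Z1 \<omega>)) = normal_measure (sqrt Q) \<Otimes>\<^sub>M normal_measure (sqrt N)"
proof -
  have "distr M borel X0 = normal_measure (sqrt Q)" "distr M borel Z1 = normal_measure (sqrt N)"
    using distributed_distr_eq_density[OF X0] distributed_distr_eq_density[OF Z1]
    by (simp_all cong: distr_cong)
  then show ?thesis using ind unfolding indep_var_distribution_eq by simp
qed

text \<open>For fixed source value \<open>x\<close> the noise is translated into the output, which
  avoids inverting the map \<open>x \<mapsto> x - a * sgn x\<close>. After swapping the integrals,
  \<open>x = source y w\<close> is substituted for fixed \<open>y\<close>, and
  \<open>joint_density\<close> identifies the integrand. Working with nonnegative functions keeps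
  integrability out of the computation.\<close>

lemma nn_integral_X0_Y1:
  assumes [measurable]: "f \<in> borel_measurable (borel \<Otimes>\<^sub>M borel)"
  shows "(\<integral>\<^sup>+\<omega>. f (X0 \<omega>, Y1 a \<omega>) \<partial>M)
    = (\<integral>\<^sup>+y. (\<integral>\<^sup>+w. ennreal (lik a y w) * f (source y w, y) \<partial>\<nu>) \<partial>\<mu>)"
proof -
  interpret q: prob_space "normal_measure (sqrt Q)" by (rule prob_space_normal_density) (use Q in simp)
  interpret n: prob_space "normal_measure (sqrt N)" by (rule prob_space_normal_density) (use N in simp)
  interpret qn: pair_prob_space "normal_measure (sqrt Q)" "normal_measure (sqrt N)" ..
  define s where "s x = x - a * sgn x" for x :: real
  have [measurable]: "s \<in> borel_measurable borel" unfolding s_def by measurable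
  have tau: "0 < tau" using Q N by (simp add: tau_def)
  let ?p = "\<lambda>x y. ennreal (normal_density 0 (sqrt Q) x) * (ennreal (normal_density 0 (sqrt N) (y - s x)) * f (x, y))"
  have "(\<integral>\<^sup>+\<omega>. f (X0 \<omega>, Y1 a \<omega>) \<partial>M)
      = (\<integral>\<^sup>+p. f (fst p, s (fst p) + snd p) \<partial>(distr M (borel \<Otimes>\<^sub>M borel) (\<lambda>\<omega>. (X0 \<omega>, Z1 \<omega>))))"
    by (subst nn_integral_distr) (auto simp: Y1_eq X1_eq s_def)
  also have "\<dots> = (\<integral>\<^sup>+x. (\<integral>\<^sup>+z. f (x, s x + z) \<partial>normal_measure (sqrt N)) \<partial>normal_measure (sqrt Q))"
    unfolding law_X0_Z1 by (subst n.nn_integral_fst[symmetric]) auto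
  also have "\<dots> = (\<integral>\<^sup>+x. ennreal (normal_density 0 (sqrt Q) x) *
      (\<integral>\<^sup>+z. ennreal (normal_density 0 (sqrt N) z) * f (x, s x + z) \<partial>lborel) \<partial>lborel)"
    by (simp add: nn_integral_density)
  also have "\<dots> = (\<integral>\<^sup>+x. ennreal (normal_density 0 (sqrt Q) x) *
      (\<integral>\<^sup>+y. ennreal (normal_density 0 (sqrt N) (y - s x)) * f (x, y) \<partial>lborel) \<partial>lborel)"
  proof (rule nn_integral_cong, rule arg_cong2[where f="(*)"], rule refl)
    fix x :: real
    show "(\<integral>\<^sup>+z. ennreal (normal_density 0 (sqrt N) z) * f (x, s x + z) \<partial>lborel)
        = (\<integral>\<^sup>+y. ennreal (normal_density 0 (sqrt N) (y - s x)) * f (x, y) \<partial>lborel)"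
      by (subst nn_integral_real_affine[where c=1 and t="- s x"]) (auto simp: algebra_simps)
  qed
  also have "\<dots> = (\<integral>\<^sup>+x. (\<integral>\<^sup>+y. ?p x y \<partial>lborel) \<partial>lborel)"
    by (simp add: nn_integral_cmult)
  also have "\<dots> = (\<integral>\<^sup>+y. (\<integral>\<^sup>+x. ?p x y \<partial>lborel) \<partial>lborel)"
    by (rule lborel_pair.Fubini'[symmetric]) auto
  also have "\<dots> = (\<integral>\<^sup>+y. ennreal (normal_density 0 (sqrt (Q + N)) y) *
      (\<integral>\<^sup>+w. ennreal (std_normal_density w) * (ennreal (lik a y w) * f (source y w, y)) \<partial>lborel) \<partial>lborel)"
  proof (rule nn_integral_cong)
    fix y :: real
    have "(\<integral>\<^sup>+x. ?p x y \<partial>lborel) = ennreal tau * (\<integral>\<^sup>+w. ?p (source y w) y \<partial>lborel)"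
      using tau by (subst nn_integral_real_affine[where c=tau and t="rho * y"]) (auto simp: source_def)
    also have "\<dots> = (\<integral>\<^sup>+w. ennreal tau * ?p (source y w) y \<partial>lborel)"
      by (simp add: nn_integral_cmult)
    also have "\<dots> = (\<integral>\<^sup>+w. ennreal (normal_density 0 (sqrt (Q + N)) y) *
        (ennreal (std_normal_density w) * (ennreal (lik a y w) * f (source y w, y))) \<partial>lborel)"
    proof (rule nn_integral_cong)
      fix w :: real
      have "ennreal tau * ?p (source y w) y = ennreal (normal_density 0 (sqrt Q) (source y w)
          * normal_density 0 (sqrt N) (y - x1 a y w) * tau) * f (source y w, y)"
        using tau by (simp add: ennreal_mult s_def x1_def mult_ac)
      also have "\<dots> = ennreal (normal_density 0 (sqrt (Q + N)) y) *
        (ennreal (std_normal_density w) * (ennreal (lik a y w) * f (source y w, y)))"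
        unfolding joint_density by (simp add: ennreal_mult lik_def mult_ac)
      finally show "ennreal tau * ?p (source y w) y = \<dots>" .
    qed
    finally show "(\<integral>\<^sup>+x. ?p x y \<partial>lborel) = ennreal (normal_density 0 (sqrt (Q + N)) y) *
      (\<integral>\<^sup>+w. ennreal (std_normal_density w) * (ennreal (lik a y w) * f (source y w, y)) \<partial>lborel)"
      by (simp add: nn_integral_cmult)
  qed
  also have "\<dots> = (\<integral>\<^sup>+y. (\<integral>\<^sup>+w. ennreal (lik a y w) * f (source y w, y) \<partial>\<nu>) \<partial>\<mu>)"
    by (simp add: nn_integral_density)
  finally show ?thesis .
qed

text \<open>The integral formula applied to indicators becomes an equality of measures, from which
  integrability and integrals of signed functions follow.\<close>

lemma law_X0_Y1:
  "distr M (borel \<Otimes>\<^sub>M borel) (\<lambda>\<omega>. (X0 \<omega>, Y1 a \<omega>))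
    = distr (density (\<mu> \<Otimes>\<^sub>M \<nu>) (\<lambda>p. ennreal (lik a (fst p) (snd p)))) (borel \<Otimes>\<^sub>M borel)
        (\<lambda>p. (source (fst p) (snd p), fst p))"
proof (rule measure_eqI)
  fix A assume "A \<in> sets (distr M (borel \<Otimes>\<^sub>M borel) (\<lambda>\<omega>. (X0 \<omega>, Y1 a \<omega>)))"
  then have A [measurable]: "A \<in> sets (borel \<Otimes>\<^sub>M borel)" by simp
  have "emeasure (distr M (borel \<Otimes>\<^sub>M borel) (\<lambda>\<omega>. (X0 \<omega>, Y1 a \<omega>))) A
      = (\<integral>\<^sup>+\<omega>. indicator A (X0 \<omega>, Y1 a \<omega>) \<partial>M)"
    using nn_integral_distr[of "\<lambda>\<omega>. (X0 \<omega>, Y1 a \<omega>)" M "borel \<Otimes>\<^sub>M borel" "indicator A"] by simp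
  also have "\<dots> = (\<integral>\<^sup>+y. (\<integral>\<^sup>+w. ennreal (lik a y w) * indicator A (source y w, y) \<partial>\<nu>) \<partial>\<mu>)"
    by (rule nn_integral_X0_Y1) simp
  also have "\<dots> = (\<integral>\<^sup>+p. ennreal (lik a (fst p) (snd p)) * indicator A (source (fst p) (snd p), fst p) \<partial>(\<mu> \<Otimes>\<^sub>M \<nu>))"
    by (subst nu.nn_integral_fst[symmetric]) auto
  also have "\<dots> = (\<integral>\<^sup>+p. indicator A p \<partial>distr (density (\<mu> \<Otimes>\<^sub>M \<nu>) (\<lambda>p. ennreal (lik a (fst p) (snd p))))
      (borel \<Otimes>\<^sub>M borel) (\<lambda>p. (source (fst p) (snd p), fst p)))"
    by (subst nn_integral_distr) (auto simp: nn_integral_density)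
  finally show "emeasure (distr M (borel \<Otimes>\<^sub>M borel) (\<lambda>\<omega>. (X0 \<omega>, Y1 a \<omega>))) A = emeasure
      (distr (density (\<mu> \<Otimes>\<^sub>M \<nu>) (\<lambda>p. ennreal (lik a (fst p) (snd p)))) (borel \<Otimes>\<^sub>M borel)
        (\<lambda>p. (source (fst p) (snd p), fst p))) A"
    by simp
qed simp

lemma
  fixes g :: "real \<times> real \<Rightarrow> real"
  assumes [measurable]: "g \<in> borel_measurable (borel \<Otimes>\<^sub>M borel)"
  shows integrable_X0_Y1: "integrable M (\<lambda>\<omega>. g (X0 \<omega>, Y1 a \<omega>)) \<longleftrightarrow>
      integrable (\<mu> \<Otimes>\<^sub>M \<nu>) (\<lambda>p. lik a (fst p) (snd p) * g (source (fst p) (snd p), fst p))"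
    and integral_X0_Y1: "(\<integral>\<omega>. g (X0 \<omega>, Y1 a \<omega>) \<partial>M) =
      (\<integral>p. lik a (fst p) (snd p) * g (source (fst p) (snd p), fst p) \<partial>(\<mu> \<Otimes>\<^sub>M \<nu>))"
proof -
  have [measurable]: "(\<lambda>p. lik a (fst p) (snd p)) \<in> borel_measurable (\<mu> \<Otimes>\<^sub>M \<nu>)"
    "(\<lambda>p. source (fst p) (snd p)) \<in> borel_measurable (\<mu> \<Otimes>\<^sub>M \<nu>)"
    using measurable_channel by (simp_all cong: measurable_cong_sets)
  have pos: "0 \<le> lik a y w" for y w by (simp add: lik_def)
  have "integrable M (\<lambda>\<omega>. g (X0 \<omega>, Y1 a \<omega>)) \<longleftrightarrow>
      integrable (distr M (borel \<Otimes>\<^sub>M borel) (\<lambda>\<omega>. (X0 \<omega>, Y1 a \<omega>))) g"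
    by (subst integrable_distr_eq) auto
  also have "\<dots> \<longleftrightarrow> integrable (\<mu> \<Otimes>\<^sub>M \<nu>) (\<lambda>p. lik a (fst p) (snd p) * g (source (fst p) (snd p), fst p))"
    unfolding law_X0_Y1 using pos by (subst integrable_distr_eq) (auto simp: integrable_real_density)
  finally show "integrable M (\<lambda>\<omega>. g (X0 \<omega>, Y1 a \<omega>)) \<longleftrightarrow>
      integrable (\<mu> \<Otimes>\<^sub>M \<nu>) (\<lambda>p. lik a (fst p) (snd p) * g (source (fst p) (snd p), fst p))" .
  have "(\<integral>\<omega>. g (X0 \<omega>, Y1 a \<omega>) \<partial>M) = (\<integral>p. g p \<partial>distr M (borel \<Otimes>\<^sub>M borel) (\<lambda>\<omega>. (X0 \<omega>, Y1 a \<omega>)))"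
    by (subst integral_distr) auto
  also have "\<dots> = (\<integral>p. lik a (fst p) (snd p) * g (source (fst p) (snd p), fst p) \<partial>(\<mu> \<Otimes>\<^sub>M \<nu>))"
    unfolding law_X0_Y1 using pos by (subst integral_distr) (auto simp: integral_real_density)
  finally show "(\<integral>\<omega>. g (X0 \<omega>, Y1 a \<omega>) \<partial>M) = \<dots>" .
qed

lemma nn_integral_lik:
  assumes "a \<in> {-1<..<1}"
  shows "(\<integral>\<^sup>+w. ennreal (lik a y w) \<partial>\<nu>) = ennreal (den a y)"
  unfolding den_def by (rule nn_integral_eq_integral[OF integrable_lik(1)[OF assms]]) (simp add: lik_def)

text \<open>Integrating \<open>w\<close> out of the joint law leaves \<open>den a\<close> as the
  density of the output law relative to \<open>\<mu>\<close>.\<close>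

lemma
  assumes a: "a \<in> {-1<..<1}" and k [measurable]: "k \<in> borel_measurable borel"
  shows integrable_Y1: "integrable M (\<lambda>\<omega>. k (Y1 a \<omega>)) \<longleftrightarrow> integrable \<mu> (\<lambda>y. k y * den a y)"
    and expectation_Y1: "integrable M (\<lambda>\<omega>. k (Y1 a \<omega>)) \<Longrightarrow>
      expectation (\<lambda>\<omega>. k (Y1 a \<omega>)) = (\<integral>y. k y * den a y \<partial>\<mu>)"
proof -
  have "(\<integral>\<^sup>+\<omega>. ennreal \<bar>k (Y1 a \<omega>)\<bar> \<partial>M) = (\<integral>\<^sup>+y. (\<integral>\<^sup>+w. ennreal (lik a y w) * ennreal \<bar>k y\<bar> \<partial>\<nu>) \<partial>\<mu>)"
    using nn_integral_X0_Y1[of "\<lambda>p. ennreal \<bar>k (snd p)\<bar>" a] by simp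
  also have "\<dots> = (\<integral>\<^sup>+y. ennreal \<bar>k y * den a y\<bar> \<partial>\<mu>)"
  proof (rule nn_integral_cong)
    fix y
    have "(\<integral>\<^sup>+w. ennreal (lik a y w) * ennreal \<bar>k y\<bar> \<partial>\<nu>) = ennreal (den a y) * ennreal \<bar>k y\<bar>"
      by (subst nn_integral_multc) (auto simp: nn_integral_lik[OF a])
    then show "(\<integral>\<^sup>+w. ennreal (lik a y w) * ennreal \<bar>k y\<bar> \<partial>\<nu>) = ennreal \<bar>k y * den a y\<bar>"
      using den_pos[OF a, of y] by (simp add: abs_mult ennreal_mult mult.commute)
  qed
  finally show "integrable M (\<lambda>\<omega>. k (Y1 a \<omega>)) \<longleftrightarrow> integrable \<mu> (\<lambda>y. k y * den a y)"
    by (simp add: integrable_iff_bounded)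
  assume "integrable M (\<lambda>\<omega>. k (Y1 a \<omega>))"
  then have i: "integrable (\<mu> \<Otimes>\<^sub>M \<nu>) (\<lambda>p. lik a (fst p) (snd p) * k (fst p))"
    using integrable_X0_Y1[of "\<lambda>p. k (snd p)" a] by simp
  have "expectation (\<lambda>\<omega>. k (Y1 a \<omega>)) = (\<integral>p. lik a (fst p) (snd p) * k (fst p) \<partial>(\<mu> \<Otimes>\<^sub>M \<nu>))"
    using integral_X0_Y1[of "\<lambda>p. k (snd p)" a] by simp
  also have "\<dots> = (\<integral>y. (\<integral>w. lik a y w * k y \<partial>\<nu>) \<partial>\<mu>)"
    using munu.integral_fst'[OF i] by simp
  finally show "expectation (\<lambda>\<omega>. k (Y1 a \<omega>)) = (\<integral>y. k y * den a y \<partial>\<mu>)"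
    by (simp add: den_def mult.commute)
qed

text \<open>Integrating \<open>w\<close> out against \<open>x1 * lik\<close> leaves
  \<open>num a\<close>. With indicators for \<open>k\<close>, this is the defining property of the
  conditional mean, up to the weight \<open>den a\<close>.\<close>

lemma expectation_X1_Y1:
  assumes k [measurable]: "k \<in> borel_measurable borel"
    and int: "integrable M (\<lambda>\<omega>. X1 a \<omega> * k (Y1 a \<omega>))"
  shows "expectation (\<lambda>\<omega>. X1 a \<omega> * k (Y1 a \<omega>)) = (\<integral>y. k y * num a y \<partial>\<mu>)"
proof -
  let ?g = "\<lambda>p. (fst p - a * sgn (fst p)) * k (snd p)"
  have i: "integrable (\<mu> \<Otimes>\<^sub>M \<nu>) (\<lambda>p. lik a (fst p) (snd p) * (x1 a (fst p) (snd p) * k (fst p)))"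
    using int integrable_X0_Y1[of ?g a] by (simp add: X1_eq x1_def)
  have "expectation (\<lambda>\<omega>. X1 a \<omega> * k (Y1 a \<omega>))
      = (\<integral>p. lik a (fst p) (snd p) * (x1 a (fst p) (snd p) * k (fst p)) \<partial>(\<mu> \<Otimes>\<^sub>M \<nu>))"
    using integral_X0_Y1[of ?g a] by (simp add: X1_eq x1_def)
  also have "\<dots> = (\<integral>y. (\<integral>w. k y * (x1 a y w * lik a y w) \<partial>\<nu>) \<partial>\<mu>)"
    using munu.integral_fst'[OF i] by (simp add: mult_ac)
  finally show ?thesis by (simp add: num_def)
qed

section \<open>Moments of source, noise, input and output\<close>

lemma integrable_X0_power: "integrable M (\<lambda>\<omega>. \<bar>X0 \<omega>\<bar> ^ k)"
  using distributed_integrable[OF X0, of "\<lambda>x. \<bar>x\<bar> ^ k"] integrable_normal_moment_abs[of "sqrt Q" 0 k] Q by simp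

lemma integrable_Z1_power: "integrable M (\<lambda>\<omega>. \<bar>Z1 \<omega>\<bar> ^ k)"
  using distributed_integrable[OF Z1, of "\<lambda>x. \<bar>x\<bar> ^ k"] integrable_normal_moment_abs[of "sqrt N" 0 k] N by simp

lemma integrable_Z1: "integrable M Z1"
  using integrable_Z1_power[of 1] by (simp add: integrable_abs_iff)

lemma X0_second_moment: "expectation (\<lambda>\<omega>. (X0 \<omega>)\<^sup>2) = Q"
  using distributed_integral[OF X0, of "\<lambda>x. x\<^sup>2"] integral_normal_moment_even[of "sqrt Q" 0 1] Q by simp

lemma Z1_second_moment: "expectation (\<lambda>\<omega>. (Z1 \<omega>)\<^sup>2) = N"
  using distributed_integral[OF Z1, of "\<lambda>x. x\<^sup>2"] integral_normal_moment_even[of "sqrt N" 0 1] N by simp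

lemma Z1_mean: "expectation Z1 = 0"
  using normal_distributed_expectation[OF _ Z1] N by simp

definition mean_abs where "mean_abs = expectation (\<lambda>\<omega>. \<bar>X0 \<omega>\<bar>)"

lemma mean_abs_pos: "0 < mean_abs"
  using distributed_integral[OF X0, of "\<lambda>x. \<bar>x\<bar>"] integral_normal_moment_abs_odd[of "sqrt Q" 0 0] Q
  by (simp add: mean_abs_def)

text \<open>Since \<open>sgn 0 = 0\<close>, the exceptional event is \<open>X0 = 0\<close>, which is
  null because \<open>X0\<close> has a density.\<close>

lemma AE_sgn_X0: "AE \<omega> in M. (sgn (X0 \<omega>))\<^sup>2 = 1"
proof -
  have "AE x in lborel. x \<noteq> (0::real)" by (rule AE_lborel_singleton)
  then have "AE x in distr M lborel X0. x \<noteq> 0"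
    unfolding distributed_distr_eq_density[OF X0] by (auto simp: AE_density)
  then have "AE \<omega> in M. X0 \<omega> \<noteq> 0" by (subst (asm) AE_distr_iff) auto
  then show ?thesis by eventually_elim (simp add: sgn_if)
qed

lemma power_cost_bpsk: "power_cost M X0 (bpsk a) = a\<^sup>2"
proof -
  have "power_cost M X0 (bpsk a) = (\<integral>\<omega>. a\<^sup>2 \<partial>M)"
    unfolding power_cost_def
    by (rule integral_cong_AE) (use AE_sgn_X0 in \<open>auto simp: bpsk_def power_mult_distrib\<close>)
  then show ?thesis by (simp add: prob_space)
qed

lemma AE_X1_sq: "AE \<omega> in M. (X1 a \<omega>)\<^sup>2 = (X0 \<omega>)\<^sup>2 - 2 * a * \<bar>X0 \<omega>\<bar> + a\<^sup>2"
  using AE_sgn_X0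
proof eventually_elim
  case (elim \<omega>)
  then show ?case
    unfolding X1_eq power2_diff power_mult_distrib by (simp add: abs_sgn mult_ac)
qed

lemma integrable_X1_sq: "integrable M (\<lambda>\<omega>. (X1 a \<omega>)\<^sup>2)"
  by (subst integrable_cong_AE[OF _ _ AE_X1_sq])
    (use integrable_X0_power[of 1] integrable_X0_power[of 2] in auto)

lemma X1_second_moment: "expectation (\<lambda>\<omega>. (X1 a \<omega>)\<^sup>2) = Q - 2 * a * mean_abs + a\<^sup>2"
  by (subst integral_cong_AE[OF _ _ AE_X1_sq])
    (use integrable_X0_power[of 1] integrable_X0_power[of 2] X0_second_moment in \<open>auto simp: mean_abs_def prob_space\<close>)

lemma integrable_X1: "integrable M (X1 a)"
  by (rule square_integrable_imp_integrable) (use integrable_X1_sq in auto)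

lemma integrable_X1_Z1: "integrable M (\<lambda>\<omega>. X1 a \<omega> * Z1 \<omega>)"
  by (rule integrable_mult_of_squares) (use integrable_X1_sq integrable_Z1_power[of 2] in auto)

lemma integrable_Y1_sq: "integrable M (\<lambda>\<omega>. (Y1 a \<omega>)\<^sup>2)"
  unfolding Y1_eq power2_sum
  using integrable_X1_sq integrable_Z1_power[of 2] integrable_X1_Z1 by (simp add: mult.assoc)

lemma X1_Z1_uncorrelated: "expectation (\<lambda>\<omega>. X1 a \<omega> * Z1 \<omega>) = 0"
proof -
  have "indep_var borel ((\<lambda>x. x - a * sgn x) \<circ> X0) borel ((\<lambda>x. x) \<circ> Z1)"
    by (rule indep_var_compose[OF ind]) auto
  then have "indep_var borel (X1 a) borel Z1" by (simp add: X1_eq[abs_def] comp_def)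
  from indep_var_lebesgue_integral[OF this integrable_X1 integrable_Z1] show ?thesis
    by (simp add: Z1_mean)
qed

section \<open>The conditional mean and the cost of BPSK\<close>

definition est where "est a y = num a y / den a y"

lemma measurable_est [measurable]: "est a \<in> borel_measurable borel"
  unfolding est_def[abs_def] by measurable

lemma est_simps:
  assumes "a \<in> {-1<..<1}"
  shows "est a y * den a y = num a y" "(est a y)\<^sup>2 * den a y = energy a y" "est a y * num a y = energy a y"
  using den_pos[OF assms, of y] by (simp_all add: est_def energy_def power2_eq_square)

lemma integrable_est_sq:
  assumes "a \<in> {-1<..<1}"
  shows "integrable M (\<lambda>\<omega>. (est a (Y1 a \<omega>))\<^sup>2)"
  using integrable_Y1[OF assms, of "\<lambda>y. (est a y)\<^sup>2"] integrable_energy[OF assms]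
  by (simp add: est_simps[OF assms])

text \<open>Events of the generated sigma-algebra are preimages of Borel sets \<open>B\<close>. Over
  such an event both \<open>X1\<close> and the estimate integrate to the
  \<open>\<mu>\<close>-integral of \<open>num a\<close> over \<open>B\<close>, because
  \<open>est * den = num\<close>.\<close>

lemma real_cond_exp_X1:
  assumes a: "a \<in> {-1<..<1}"
  shows "AE \<omega> in M. real_cond_exp M (vimage_algebra (space M) (Y1 a) borel) (X1 a) \<omega> = est a (Y1 a \<omega>)"
proof -
  let ?F = "vimage_algebra (space M) (Y1 a) borel"
  have sub: "subalgebra M ?F"
    unfolding subalgebra_def using sets_image_in_sets[of M "space M" "Y1 a" borel] by auto
  interpret F: finite_measure_subalgebra M ?F by unfold_locales (rule sub)
  have intE: "integrable M (\<lambda>\<omega>. est a (Y1 a \<omega>))"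
    by (rule square_integrable_imp_integrable) (use integrable_est_sq[OF a] in auto)
  show ?thesis
  proof (rule F.real_cond_exp_charact)
    fix A assume "A \<in> sets ?F"
    then obtain B where B [measurable]: "B \<in> sets borel" and A: "A = Y1 a -` B \<inter> space M"
      by (auto simp: sets_vimage_algebra2)
    have ind_eq: "(LINT \<omega>:A|M. f \<omega>) = expectation (\<lambda>\<omega>. f \<omega> * indicator B (Y1 a \<omega>))" for f :: "'a \<Rightarrow> real"
      unfolding set_lebesgue_integral_def
      by (rule Bochner_Integration.integral_cong) (auto simp: A indicator_def)
    have "(LINT \<omega>:A|M. X1 a \<omega>) = (\<integral>y. indicator B y * num a y \<partial>\<mu>)"
      unfolding ind_eq
    proof (rule expectation_X1_Y1)
      show "integrable M (\<lambda>\<omega>. X1 a \<omega> * indicator B (Y1 a \<omega>))"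
        by (rule Bochner_Integration.integrable_bound[OF integrable_X1[of a]]) (auto simp: indicator_def)
    qed simp
    also have "\<dots> = (\<integral>y. (est a y * indicator B y) * den a y \<partial>\<mu>)"
      by (rule Bochner_Integration.integral_cong) (auto simp: est_simps(1)[OF a, symmetric])
    also have "\<dots> = (LINT \<omega>:A|M. est a (Y1 a \<omega>))"
      unfolding ind_eq 
    proof (rule expectation_Y1[OF a, of "\<lambda>y. est a y * indicator B y", symmetric])
      show "integrable M (\<lambda>\<omega>. est a (Y1 a \<omega>) * indicator B (Y1 a \<omega>))"
        by (rule Bochner_Integration.integrable_bound[OF intE]) (auto simp: indicator_def)
    qed simp
    finally show "(LINT \<omega>:A|M. X1 a \<omega>) = (LINT \<omega>:A|M. est a (Y1 a \<omega>))" .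
  next
    show "(\<lambda>\<omega>. est a (Y1 a \<omega>)) \<in> borel_measurable ?F"
      by (rule measurable_compose[OF measurable_vimage_algebra1 measurable_est]) simp
  qed (use integrable_X1 intE in auto)
qed

lemma integrable_X1_est:
  assumes "a \<in> {-1<..<1}"
  shows "integrable M (\<lambda>\<omega>. X1 a \<omega> * est a (Y1 a \<omega>))"
  by (rule integrable_mult_of_squares) (use integrable_X1_sq integrable_est_sq[OF assms] in auto)

text \<open>In the expanded square, the mixed moment of \<open>X1\<close> and the estimate equals
  the second moment of the estimate, both being the integral of \<open>energy\<close>. Only the
  second moment of \<open>X1\<close> minus that integral survives.\<close>

lemma S_bpsk_eq:
  assumes a: "a \<in> {-1<..<1}"
  shows "S_bpsk M X0 Z1 a = Q - 2 * a * mean_abs + a\<^sup>2 - (\<integral>y. energy a y \<partial>\<mu>)"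
proof -
  have "S_bpsk M X0 Z1 a = expectation (\<lambda>\<omega>. (X1 a \<omega> - est a (Y1 a \<omega>))\<^sup>2)"
    unfolding S_bpsk_def est_cost_def X1_def[symmetric] Y1_def[symmetric]
    by (rule integral_cong_AE) (use real_cond_exp_X1[OF a] in auto)
  also have "\<dots> = expectation (\<lambda>\<omega>. (X1 a \<omega>)\<^sup>2 + (est a (Y1 a \<omega>))\<^sup>2 - 2 * (X1 a \<omega> * est a (Y1 a \<omega>)))"
    by (simp add: power2_diff mult.assoc)
  also have "\<dots> = expectation (\<lambda>\<omega>. (X1 a \<omega>)\<^sup>2) + expectation (\<lambda>\<omega>. (est a (Y1 a \<omega>))\<^sup>2)
      - 2 * expectation (\<lambda>\<omega>. X1 a \<omega> * est a (Y1 a \<omega>))"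
    using integrable_X1_sq integrable_est_sq[OF a] integrable_X1_est[OF a] by simp
  also have "expectation (\<lambda>\<omega>. (est a (Y1 a \<omega>))\<^sup>2) = (\<integral>y. energy a y \<partial>\<mu>)"
    using expectation_Y1[OF a _ integrable_est_sq[OF a]] by (simp add: est_simps[OF a])
  also have "expectation (\<lambda>\<omega>. X1 a \<omega> * est a (Y1 a \<omega>)) = (\<integral>y. energy a y \<partial>\<mu>)"
    using expectation_X1_Y1[OF _ integrable_X1_est[OF a]] by (simp add: est_simps[OF a])
  finally show ?thesis by (simp add: X1_second_moment)
qed

section \<open>Comparison with the estimator \<open>rho * Y1\<close>\<close>

definition linear_est_cost where
  "linear_est_cost a = (1 - rho)\<^sup>2 * (Q - 2 * a * mean_abs + a\<^sup>2) + rho\<^sup>2 * N"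

text \<open>The error is \<open>(1 - rho) * X1 - rho * Z1\<close> with uncorrelated terms. As
  \<open>rho\<close> is held fixed while \<open>a\<close> varies, the cost is a quadratic polynomial
  in \<open>a\<close>.\<close>

lemma linear_est_cost_eq: "expectation (\<lambda>\<omega>. (X1 a \<omega> - rho * Y1 a \<omega>)\<^sup>2) = linear_est_cost a"
proof -
  have "(X1 a \<omega> - rho * Y1 a \<omega>)\<^sup>2
      = (1 - rho)\<^sup>2 * (X1 a \<omega>)\<^sup>2 - (2 * rho * (1 - rho)) * (X1 a \<omega> * Z1 \<omega>) + rho\<^sup>2 * (Z1 \<omega>)\<^sup>2" for \<omega>
    unfolding Y1_eq by (simp add: power2_eq_square algebra_simps)
  then show ?thesis
    using integrable_X1_sq integrable_X1_Z1 integrable_Z1_power[of 2]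
    by (simp add: X1_Z1_uncorrelated X1_second_moment Z1_second_moment linear_est_cost_def)
qed

text \<open>The estimate and \<open>X1\<close> have the same mixed moment with \<open>Y1\<close>.
  Hence the excess of the linear estimator is exactly the second moment of
  \<open>est - rho * Y1\<close>, which is nonnegative.\<close>

lemma S_bpsk_le_linear_est_cost:
  assumes a: "a \<in> {-1<..<1}"
  shows "S_bpsk M X0 Z1 a \<le> linear_est_cost a"
proof -
  have XY: "integrable M (\<lambda>\<omega>. X1 a \<omega> * Y1 a \<omega>)"
    by (rule integrable_mult_of_squares) (use integrable_X1_sq integrable_Y1_sq in auto)
  have EY: "integrable M (\<lambda>\<omega>. est a (Y1 a \<omega>) * Y1 a \<omega>)"
    by (rule integrable_mult_of_squares) (use integrable_est_sq[OF a] integrable_Y1_sq in auto)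
  have "expectation (\<lambda>\<omega>. est a (Y1 a \<omega>) * Y1 a \<omega>) = (\<integral>y. (est a y * y) * den a y \<partial>\<mu>)"
    by (rule expectation_Y1[OF a _ EY]) simp
  also have "\<dots> = (\<integral>y. y * num a y \<partial>\<mu>)"
    by (rule Bochner_Integration.integral_cong) (auto simp: est_simps(1)[OF a, symmetric])
  also have "\<dots> = expectation (\<lambda>\<omega>. X1 a \<omega> * Y1 a \<omega>)"
    by (rule expectation_X1_Y1[OF _ XY, symmetric]) simp
  finally have eq: "expectation (\<lambda>\<omega>. est a (Y1 a \<omega>) * Y1 a \<omega>) = expectation (\<lambda>\<omega>. X1 a \<omega> * Y1 a \<omega>)" .
  have energy: "expectation (\<lambda>\<omega>. (est a (Y1 a \<omega>))\<^sup>2) = (\<integral>y. energy a y \<partial>\<mu>)"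
    using expectation_Y1[OF a _ integrable_est_sq[OF a]] by (simp add: est_simps[OF a])
  have "0 \<le> expectation (\<lambda>\<omega>. (est a (Y1 a \<omega>) - rho * Y1 a \<omega>)\<^sup>2)" by simp
  also have "\<dots> = expectation (\<lambda>\<omega>. (est a (Y1 a \<omega>))\<^sup>2 - 2 * rho * (est a (Y1 a \<omega>) * Y1 a \<omega>) + rho\<^sup>2 * (Y1 a \<omega>)\<^sup>2)"
    by (rule Bochner_Integration.integral_cong) (auto simp: power2_eq_square algebra_simps)
  also have "\<dots> = (\<integral>y. energy a y \<partial>\<mu>) - 2 * rho * expectation (\<lambda>\<omega>. X1 a \<omega> * Y1 a \<omega>) + rho\<^sup>2 * expectation (\<lambda>\<omega>. (Y1 a \<omega>)\<^sup>2)"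
    using integrable_est_sq[OF a] EY integrable_Y1_sq by (simp add: eq energy)
  finally have pos: "0 \<le> \<dots>" .
  have "linear_est_cost a = expectation (\<lambda>\<omega>. (X1 a \<omega>)\<^sup>2 - 2 * rho * (X1 a \<omega> * Y1 a \<omega>) + rho\<^sup>2 * (Y1 a \<omega>)\<^sup>2)"
    unfolding linear_est_cost_eq[symmetric]
    by (rule Bochner_Integration.integral_cong) (auto simp: power2_eq_square algebra_simps)
  also have "\<dots> = (Q - 2 * a * mean_abs + a\<^sup>2) - 2 * rho * expectation (\<lambda>\<omega>. X1 a \<omega> * Y1 a \<omega>) + rho\<^sup>2 * expectation (\<lambda>\<omega>. (Y1 a \<omega>)\<^sup>2)"
    using integrable_X1_sq XY integrable_Y1_sq by (simp add: X1_second_moment)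
  finally show ?thesis using pos S_bpsk_eq[OF a] by linarith
qed

lemma lik_0: "lik 0 y w = 1" "x1 0 y w = source y w"
  by (simp_all add: lik_def x1_def)

text \<open>At amplitude \<open>0\<close> the likelihood ratio is 1 and the conditional mean is the
  linear function \<open>rho * y\<close>.\<close>

lemma energy_0: "energy 0 y = rho\<^sup>2 * y\<^sup>2"
proof -
  have n1: "(\<integral>w. w \<partial>\<nu>) = 0"
    using integral_std_normal_moment_odd[of 0] by (simp add: integral_real_density)
  have n2: "integrable \<nu> (\<lambda>w. w)"
    using integrable_std_normal_moment[of 1] by (simp add: integrable_real_density)
  have "den 0 y = 1" using nu.prob_space by (simp add: den_def lik_0)
  moreover have "num 0 y = rho * y"
    using n1 n2 nu.prob_space by (simp add: num_def lik_0 source_def)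
  ultimately show ?thesis by (simp add: energy_def power_mult_distrib)
qed

lemma S_bpsk_0: "S_bpsk M X0 Z1 0 = Q * N / (Q + N)" and linear_est_cost_0: "linear_est_cost 0 = Q * N / (Q + N)"
proof -
  have QN: "Q + N \<noteq> 0" using Q N by simp
  have "(\<integral>y. y\<^sup>2 \<partial>\<mu>) = Q + N"
    using integral_normal_moment_even[of "sqrt (Q + N)" 0 1] Q N by (simp add: integral_real_density)
  then have "S_bpsk M X0 Z1 0 = Q - rho\<^sup>2 * (Q + N)"
    by (subst S_bpsk_eq) (simp_all add: energy_0[abs_def])
  also have "rho\<^sup>2 * (Q + N) = rho * Q" using QN by (simp add: rho_def power2_eq_square)
  also have "Q - rho * Q = Q * N / (Q + N)"
    using QN by (simp add: rho_def field_simps)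
  finally show "S_bpsk M X0 Z1 0 = Q * N / (Q + N)" .
  have r: "1 - rho = N / (Q + N)" using QN by (simp add: rho_def field_simps)
  have "N\<^sup>2 * Q + Q\<^sup>2 * N = Q * N * (Q + N)" by (simp add: power2_eq_square algebra_simps)
  then have "(N\<^sup>2 * Q + Q\<^sup>2 * N) / (Q + N)\<^sup>2 = Q * N / (Q + N)"
    using QN by (simp add: power2_eq_square)
  then show "linear_est_cost 0 = Q * N / (Q + N)"
    unfolding linear_est_cost_def r by (simp add: rho_def power_divide add_divide_distrib)
qed

section \<open>The derivative of the BPSK cost near amplitude zero\<close>

definition bpsk_cost' where "bpsk_cost' a = - 2 * mean_abs + 2 * a - (\<integral>y. energy' a y \<partial>\<mu>)"

lemma S_bpsk_deriv:
  assumes a: "a \<in> {-1<..<1}"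
  shows "(S_bpsk M X0 Z1 has_real_derivative bpsk_cost' a) (at a)"
proof -
  have "((\<lambda>a. Q - 2 * a * mean_abs + a\<^sup>2 - (\<integral>y. energy a y \<partial>\<mu>)) has_real_derivative bpsk_cost' a) (at a)"
    unfolding bpsk_cost'_def by (auto intro!: derivative_eq_intros integral_energy_deriv[OF a])
  then show ?thesis
    by (rule has_field_derivative_transform_within_open[OF _ open_greaterThanLessThan a])
      (simp add: S_bpsk_eq)
qed

lemma bpsk_cost'_0: "bpsk_cost' 0 = - 2 * (1 - rho)\<^sup>2 * mean_abs"
proof -
  have l: "(linear_est_cost has_real_derivative - 2 * (1 - rho)\<^sup>2 * mean_abs) (at 0)"
    unfolding linear_est_cost_def[abs_def] by (auto intro!: derivative_eq_intros)
  have d: "((\<lambda>a. linear_est_cost a - S_bpsk M X0 Z1 a) has_real_derivative - 2 * (1 - rho)\<^sup>2 * mean_abs - bpsk_cost' 0) (at 0)"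
    by (rule DERIV_diff[OF l S_bpsk_deriv]) simp
  \<comment> \<open>The gap between the two costs is nonnegative for
    \<open>\<bar>a\<bar> < 1\<close> and zero at \<open>a = 0\<close>. As negative amplitudes are
    included, this is an interior minimum and the derivative of the gap vanishes.\<close>
  have "- 2 * (1 - rho)\<^sup>2 * mean_abs - bpsk_cost' 0 = 0"
    by (rule DERIV_local_min[OF d zero_less_one])
      (use S_bpsk_le_linear_est_cost in \<open>auto simp: S_bpsk_0 linear_est_cost_0 abs_less_iff\<close>)
  then show ?thesis by simp
qed

lemma bpsk_cost'_tendsto: "(bpsk_cost' \<longlongrightarrow> bpsk_cost' 0) (at 0)"
  unfolding bpsk_cost'_def[abs_def] by (intro tendsto_intros integral_energy'_tendsto) simp

text \<open>Since \<open>N > 0\<close> gives \<open>rho < 1\<close>, the derivative in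
  \<open>a\<close> has a strictly negative limit, and the factor \<open>1 / (2 * a)\<close> from the
  chain rule for the power \<open>a\<^sup>2\<close> tends to infinity.\<close>

lemma bpsk_cost'_quotient_at_bot: "filterlim (\<lambda>a. bpsk_cost' a / (2 * a)) at_bot (at_right 0)"
proof -
  have "rho < 1" using Q N by (simp add: rho_def)
  then have "0 < (1 - rho)\<^sup>2 * mean_abs" using mean_abs_pos by simp
  then have neg: "bpsk_cost' 0 < 0" by (simp add: bpsk_cost'_0 mult.commute)
  have lim: "(bpsk_cost' \<longlongrightarrow> bpsk_cost' 0) (at_right 0)"
    by (rule tendsto_mono[OF _ bpsk_cost'_tendsto]) (simp add: at_le)
  have "filterlim (\<lambda>a::real. 1 / (2 * a)) at_top (at_right 0)" by real_asymp
  from filterlim_tendsto_neg_mult_at_bot[OF lim neg this] show ?thesis by simp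
qed

end

section \<open>The linear strategy and the conclusion\<close>

lemma S_lin_0: "Q > 0 \<Longrightarrow> S_lin Q N 0 = Q * N / (Q + N)"
  by (simp add: S_lin_def)

text \<open>With \<open>g\<close> the squared difference of the roots,
  \<open>g * N / (g + N)\<close> has slope \<open>N\<^sup>2 / (g + N)\<^sup>2\<close> in
  \<open>g\<close>; the chain rule contributes the factor with \<open>1 / sqrt P\<close>.\<close>

lemma S_lin_deriv:
  assumes "0 < N" "0 < P"
  shows "(S_lin Q N has_real_derivative
    - (N\<^sup>2 / ((sqrt Q - sqrt P)\<^sup>2 + N)\<^sup>2) * (sqrt Q - sqrt P) / sqrt P) (at P)"
proof -
  let ?g = "(sqrt Q - sqrt P)\<^sup>2"
  let ?d = "- (sqrt Q - sqrt P) / sqrt P"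
  have pos: "?g + N > 0" using assms by (simp add: add_nonneg_pos)
  have g: "((\<lambda>P. (sqrt Q - sqrt P)\<^sup>2) has_real_derivative ?d) (at P)"
    using assms by (auto intro!: derivative_eq_intros simp: field_simps)
  have "(S_lin Q N has_real_derivative
      (?d * N * (?g + N) - ?g * N * (?d + 0)) / ((?g + N) * (?g + N))) (at P)"
    unfolding S_lin_def[abs_def]
    by (rule DERIV_divide[OF DERIV_cmult_right[OF g] DERIV_add[OF g DERIV_const]]) (use pos in simp)
  also have "?d * N * (?g + N) - ?g * N * (?d + 0) = N\<^sup>2 * ?d"
  proof -
    have "d * N * (g + N) - g * N * (d + 0) = N\<^sup>2 * d" for d g
      by (simp add: algebra_simps power2_eq_square)
    then show ?thesis .
  qed
  also have "N\<^sup>2 * ?d / ((?g + N) * (?g + N)) = - (N\<^sup>2 / (?g + N)\<^sup>2) * (sqrt Q - sqrt P) / sqrt P"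
  proof -
    have "N\<^sup>2 * (- u / r) / (v * v) = - (N\<^sup>2 / v\<^sup>2) * u / r" for u v r :: real
      by (simp add: power2_eq_square mult_ac)
    then show ?thesis .
  qed
  finally show ?thesis .
qed

text \<open>The factor in front of \<open>1 / sqrt P\<close> has a negative limit at
  \<open>P = 0\<close>, so the blow-up of \<open>1 / sqrt P\<close> decides.\<close>

lemma S_lin_deriv_at_bot:
  assumes "0 < Q" "0 < N"
  shows "filterlim (\<lambda>P. - (N\<^sup>2 / ((sqrt Q - sqrt P)\<^sup>2 + N)\<^sup>2) * (sqrt Q - sqrt P) / sqrt P) at_bot (at_right 0)"
proof -
  let ?l = "- (N\<^sup>2 / ((sqrt Q - sqrt 0)\<^sup>2 + N)\<^sup>2) * (sqrt Q - sqrt 0)"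
  have lim: "((\<lambda>P. - (N\<^sup>2 / ((sqrt Q - sqrt P)\<^sup>2 + N)\<^sup>2) * (sqrt Q - sqrt P)) \<longlongrightarrow> ?l) (at_right 0)"
    using assms by (intro tendsto_intros) (auto simp: add_nonneg_eq_0_iff)
  have neg: "?l < 0" using assms by simp
  have "filterlim (\<lambda>P::real. 1 / sqrt P) at_top (at_right 0)" by real_asymp
  from filterlim_tendsto_neg_mult_at_bot[OF lim neg this] show ?thesis by simp
qed

theorem theorem2:
  fixes Q N :: real and M :: "'a measure" and X0 Z1 :: "'a \<Rightarrow> real"
  assumes Q: "Q > 0" and N: "N > 0"
    and M: "prob_space M"
    and X0: "distributed M lborel X0 (\<lambda>x. ennreal (normal_density 0 (sqrt Q) x))"
    and Z1: "distributed M lborel Z1 (\<lambda>x. ennreal (normal_density 0 (sqrt N) x))"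
    and ind: "prob_space.indep_var M borel X0 borel Z1"
  shows "(\<exists>S'. (\<forall>\<^sub>F P in at_right 0. (S_lin Q N has_real_derivative S' P) (at P))
              \<and> filterlim S' at_bot (at_right 0))
       \<and> S_lin Q N 0 = Q * N / (Q + N)
       \<and> (\<forall>a\<ge>0. power_cost M X0 (bpsk a) = a^2)
       \<and> (\<exists>S'. (\<forall>\<^sub>F a in at_right 0. (S_bpsk M X0 Z1 has_real_derivative S' a) (at a))
              \<and> filterlim (\<lambda>a. S' a / (2 * a)) at_bot (at_right 0))
       \<and> S_bpsk M X0 Z1 0 = Q * N / (Q + N)"
proof -
  interpret gaussian_source_channel Q N M X0 Z1
    by (intro gaussian_source_channel.intro gaussian_channel.intro gaussian_source_channel_axioms.intro assms)
  have lin: "\<forall>\<^sub>F P in at_right 0. (S_lin Q N has_real_derivative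
      - (N\<^sup>2 / ((sqrt Q - sqrt P)\<^sup>2 + N)\<^sup>2) * (sqrt Q - sqrt P) / sqrt P) (at P)"
    using eventually_at_right_less by eventually_elim (rule S_lin_deriv[OF N])
  have bp: "\<forall>\<^sub>F a in at_right 0. (S_bpsk M X0 Z1 has_real_derivative bpsk_cost' a) (at a)"
    using eventually_at_right_real[of 0 "1::real"] by (auto elim!: eventually_mono intro: S_bpsk_deriv)
  show ?thesis
    by (intro conjI exI[of _ bpsk_cost'] allI impI
        exI[of _ "\<lambda>P. - (N\<^sup>2 / ((sqrt Q - sqrt P)\<^sup>2 + N)\<^sup>2) * (sqrt Q - sqrt P) / sqrt P"]
        lin S_lin_deriv_at_bot[OF Q N] S_lin_0[OF Q] power_cost_bpsk bp bpsk_cost'_quotient_at_bot S_bpsk_0)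
qed

end
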